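(* Let $T\ge T_0=2445999556027$, let $R$ be a real number with $2T-1<R\le 2T+1$, and let $\nabla(s)$ be the pseudogamma function with parameter $R$. Let $0<\eta<\tfrac14$, let $\tfrac12<X<1$, and let $Y=Y_0+\tfrac{\eta}{4}$ and $Y_1=Y_0+\tfrac{3\eta}{4}$ for a real number $Y_0$ such that $T-\tfrac{\eta}{4}<Y<Y_1<T+\tfrac{3\eta}{4}$. Let $\sigma_0=\tfrac54$, $T-\tfrac32<t_0\le T+\tfrac32$, $s_0=\sigma_0+it_0$, and set $$\mathbf{C}(s)=\frac{\nabla(\tfrac32+s)}{\nabla(X-\tfrac12+s)},\qquad \mathbf{D}(s)=\frac{\nabla(s+iY_1)}{\nabla(s+iY)}.$$ Then for all $s\in\mathbb{C}$ with $|s-s_0|=1$, $$\left|\frac{\mathbf{C}(s)}{\mathbf{C}(s_0)}\right|\le T^{11/T^{1/4}},\qquad \left|\frac{\mathbf{D}(s)}{\mathbf{D}(s_0)}\right|\le T^{11/T^{1/4}}.$$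
   Context: The Riemann xi-function is $\xi(s)=\tfrac12 s(s-1)\pi^{-s/2}\Gamma(s/2)\zeta(s)$, an entire function with $\xi(1/2)>0.497$. For a real number $R\ge R_0=4891999112053=2T_0-1$ put $W_1=3R+R^{1/4}+\tfrac12$, $W_2=3R+\tfrac12$, $\grave\gamma=0.3674$, $\omega=\xi(1/2)$, $\Omega=\frac{47.545}{\xi(1/2)}$, $$q=\frac{(R+10)\log(R/2)+4\log\Omega}{4\,\grave\gamma\,R^{1/4}},\qquad K=\left\lfloor\frac{\log\left[\tfrac{10}{27}\left(15+\tfrac{4}{R^{3/4}}\right)R^{1/4}+\tfrac{2}{3R^{3/4}}\right]+2\log R}{\log 2}\right\rfloor.$$ The pseudogamma function with parameter $R$ is $$\nabla(s)=\omega\left(\frac{W_2-1/2}{W_1-1/2}\right)^{q}\left[\prod_{k=1}^{2^{K+1}}\mathscr{P}(k;s)\right]^{q/2^{K+1}},\qquad \mathscr{P}(k;s)=\frac{(s-\frac12)-e^{ik\pi/2^K}(W_1-\frac12)}{(s-\frac12)-e^{ik\pi/2^K}(W_2-\frac12)}.$$ On the disc $|s-\frac12|<3R$ the product has no zeros or poles, and the power is the analytic branch with $\nabla(1/2)=\xi(1/2)$; only absolute values of $\nabla$ enter the claim, and these do not depend on the branch. *)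

theory Defs
  imports "HOL-Complex_Analysis.Complex_Analysis"
begin

section \<open>The Riemann zeta and xi functions\<close>

text \<open>
  \<open>zeta_continuation a f\<close>: on the half-plane \<open>Re z > a\<close> punctured at the pole, \<open>f\<close> is a
  holomorphic continuation of the Dirichlet series.  Such half-planes are nested, so by the
  identity theorem the value at \<open>s \<noteq> 1\<close> does not depend on \<open>a\<close> and \<open>f\<close>.  The value of
  \<open>riemann_zeta\<close> at the pole \<open>1\<close> is unspecified.
\<close>

definition zeta_continuation :: "real \<Rightarrow> (complex \<Rightarrow> complex) \<Rightarrow> bool" where
  "zeta_continuation a f \<longleftrightarrow>
     f holomorphic_on {z. Re z > a} - {1} \<and>
     (\<forall>z. Re z > 1 \<longrightarrow> (\<lambda>n. of_nat (Suc n) powr (-z)) sums f z)"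

definition riemann_zeta :: "complex \<Rightarrow> complex" where
  "riemann_zeta s = (THE w. \<exists>a f. a < Re s \<and> zeta_continuation a f \<and> w = f s)"

lemma zeta_continuation_unique:
  assumes f: "zeta_continuation a f" and g: "zeta_continuation b g"
    and s: "a < Re s" "b < Re s" "s \<noteq> 1"
  shows "f s = g s"
proof -
  define c where "c = max a b"
  let ?H = "{z. Re z > c}"
  have op: "open ?H" by (rule open_halfspace_Re_gt)
  have "s \<in> ?H" using s by (simp add: c_def)
  hence ne: "?H \<noteq> {}" by blast
  have "aff_dim ?H \<noteq> 1"
    using aff_dim_open[OF op ne] by simp
  hence conn: "connected (?H - {1})"
    by (intro connected_punctured_convex convex_halfspace_Re_gt)
  have "f holomorphic_on ?H - {1}" "g holomorphic_on ?H - {1}"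
    using f g unfolding zeta_continuation_def c_def
    by (auto elim!: holomorphic_on_subset)
  moreover have "complex_of_real (max c 1 + 1) \<in> {z. Re z > max c 1}" by (simp add: max_def)
  hence "{z. Re z > max c 1} \<noteq> {}" by blast
  moreover have "f z = g z" if "Re z > max c 1" for z
    using f g that unfolding zeta_continuation_def by (auto intro: sums_unique2)
  ultimately show ?thesis
    using s conn op open_halfspace_Re_gt
    by (intro analytic_continuation_open[of "{z. Re z > max c 1}" "?H - {1}" f g s])
       (auto simp: c_def max_def)
qed

lemma riemann_zeta_eq:
  assumes "zeta_continuation a f" "a < Re s" "s \<noteq> 1"
  shows "riemann_zeta s = f s"
  unfolding riemann_zeta_def using assms zeta_continuation_unique
  by (intro the_equality) blast+

text \<open>
  The limit fills in the removable singularities of the defining formula (at \<open>1\<close> and at the poles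
  of the Gamma factor), so that \<open>riemann_xi\<close> is the entire function; elsewhere it is the
  value of the formula.
\<close>

definition riemann_xi :: "complex \<Rightarrow> complex" where
  "riemann_xi s =
     Lim (at s) (\<lambda>z. z * (z - 1) / 2 * of_real pi powr (- z / 2) * Gamma (z / 2) * riemann_zeta z)"


section \<open>The pseudogamma function\<close>

definition pg_W1 :: "real \<Rightarrow> real" where
  "pg_W1 R = 3 * R + R powr (1/4) + 1/2"

definition pg_W2 :: "real \<Rightarrow> real" where
  "pg_W2 R = 3 * R + 1/2"

definition pg_gamma :: real where
  "pg_gamma = 0.3674"

text \<open>The number \<open>riemann_xi (1/2)\<close> is real.\<close>

definition pg_Omega :: real where
  "pg_Omega = 47.545 / Re (riemann_xi (1/2))"

definition pg_q :: "real \<Rightarrow> real" where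
  "pg_q R = ((R + 10) * ln (R / 2) + 4 * ln pg_Omega) / (4 * pg_gamma * R powr (1/4))"

definition pg_K :: "real \<Rightarrow> nat" where
  "pg_K R = nat \<lfloor>(ln (10/27 * (15 + 4 / R powr (3/4)) * R powr (1/4) + 2 / (3 * R powr (3/4)))
                   + 2 * ln R) / ln 2\<rfloor>"

definition pg_factor :: "real \<Rightarrow> nat \<Rightarrow> complex \<Rightarrow> complex" where
  "pg_factor R k s =
     ((s - 1/2) - cis (real k * pi / 2 ^ pg_K R) * of_real (pg_W1 R - 1/2)) /
     ((s - 1/2) - cis (real k * pi / 2 ^ pg_K R) * of_real (pg_W2 R - 1/2))"

definition pg_prod :: "real \<Rightarrow> complex \<Rightarrow> complex" where
  "pg_prod R s = (\<Prod>k = 1..2 ^ (pg_K R + 1). pg_factor R k s)"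

text \<open>
  The analytic branch of the logarithm of the product on the disc of radius \<open>3 * R\<close> about \<open>1/2\<close>
  that is real at the centre, where the product is positive.  This normalisation makes
  \<open>pseudogamma R (1/2) = riemann_xi (1/2)\<close>.  Outside the disc the value is unspecified.
\<close>

definition is_pg_log :: "real \<Rightarrow> (complex \<Rightarrow> complex) \<Rightarrow> bool" where
  "is_pg_log R L \<longleftrightarrow>
     L holomorphic_on ball (1/2) (3 * R) \<and>
     (\<forall>s\<in>ball (1/2) (3 * R). exp (L s) = pg_prod R s) \<and>
     Im (L (1/2)) = 0"

definition pg_log :: "real \<Rightarrow> complex \<Rightarrow> complex" where
  "pg_log R = (SOME L. is_pg_log R L)"

definition pseudogamma :: "real \<Rightarrow> complex \<Rightarrow> complex" where
  "pseudogamma R s =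
     riemann_xi (1/2) * of_real (((pg_W2 R - 1/2) / (pg_W1 R - 1/2)) powr pg_q R) *
     exp (of_real (pg_q R / 2 ^ (pg_K R + 1)) * pg_log R s)"

lemma pg_prod_center:
  assumes "R > 0"
  shows "pg_prod R (1/2) = of_real (((pg_W1 R - 1/2) / (pg_W2 R - 1/2)) ^ (2 ^ (pg_K R + 1)))"
proof -
  have "pg_factor R k (1/2) = of_real ((pg_W1 R - 1/2) / (pg_W2 R - 1/2))" for k
    by (simp add: pg_factor_def)
  thus ?thesis by (simp add: pg_prod_def)
qed

lemma is_pg_log_pg_log:
  assumes R: "R > 0"
  shows "is_pg_log R (pg_log R)"
proof -
  let ?B = "ball (1/2 :: complex) (3 * R)"
  have ne: "s - 1/2 - cis t * of_real w \<noteq> 0" if "s \<in> ?B" "w \<ge> 3 * R" for s t w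
  proof
    assume "s - 1/2 - cis t * of_real w = 0"
    hence "norm (s - 1/2) = norm (cis t * of_real w)" by simp
    also have "\<dots> = w" using that R by (simp add: norm_mult)
    finally show False using that by (simp add: dist_norm norm_minus_commute)
  qed
  have W: "pg_W1 R - 1/2 \<ge> 3 * R" "pg_W2 R - 1/2 \<ge> 3 * R"
    by (simp_all add: pg_W1_def pg_W2_def)
  have hol: "pg_prod R holomorphic_on ?B"
    unfolding pg_prod_def pg_factor_def
    by (intro holomorphic_intros ne W)
  have "pg_prod R s \<noteq> 0" if "s \<in> ?B" for s
    unfolding pg_prod_def pg_factor_def using ne[OF that W(1)] ne[OF that W(2)] by simp
  then obtain g where g: "g holomorphic_on ?B" "\<And>z. z \<in> ?B \<Longrightarrow> pg_prod R z = exp (g z)"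
    using contractible_imp_holomorphic_log[OF hol] convex_imp_contractible[OF convex_ball] by metis
  define r where "r = ((pg_W1 R - 1/2) / (pg_W2 R - 1/2)) ^ (2 ^ (pg_K R + 1))"
  have r: "r > 0" unfolding r_def using R W by (intro zero_less_power divide_pos_pos) auto
  have "exp (g (1/2)) = exp (of_real (ln r))"
    using g(2)[of "1/2"] R r pg_prod_center[OF R]
    by (simp add: r_def exp_of_real)
  then obtain m :: int where m: "g (1/2) = of_real (ln r) + of_int (2 * m) * of_real pi * \<i>"
    by (auto simp: exp_eq)
  define L where "L = (\<lambda>s. g s - of_int (2 * m) * of_real pi * \<i>)"
  have "exp (L s) = exp (g s)" for s
    by (subst exp_eq) (auto simp: L_def intro!: exI[of _ "-m"])
  hence "is_pg_log R L"
    unfolding is_pg_log_def using g m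
    by (auto simp: L_def intro!: holomorphic_intros)
  thus ?thesis unfolding pg_log_def by (rule someI[of "is_pg_log R"])
qed

lemma pseudogamma_center:
  assumes R: "R > 0"
  shows "pseudogamma R (1/2) = riemann_xi (1/2)"
proof -
  let ?N = "2 ^ (pg_K R + 1) :: nat"
  define t where "t = (pg_W1 R - 1/2) / (pg_W2 R - 1/2)"
  have t: "t > 0"
    unfolding t_def using R by (intro divide_pos_pos) (auto simp: pg_W1_def pg_W2_def intro: add_pos_nonneg)
  have L: "is_pg_log R (pg_log R)" by (rule is_pg_log_pg_log[OF R])
  have re: "pg_log R (1/2) = of_real (Re (pg_log R (1/2)))"
    using L by (simp add: is_pg_log_def complex_eq_iff)
  have "exp (pg_log R (1/2)) = of_real (t ^ ?N)"
    using L R pg_prod_center[OF R] by (simp add: is_pg_log_def t_def)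
  hence "complex_of_real (exp (Re (pg_log R (1/2)))) = of_real (t ^ ?N)"
    by (subst (asm) re) (simp only: exp_of_real)
  hence "exp (Re (pg_log R (1/2))) = t ^ ?N"
    by (simp only: of_real_eq_iff)
  hence "Re (pg_log R (1/2)) = ln (t ^ ?N)"
    by (metis ln_exp)
  also have "\<dots> = ?N * ln t"
    using t by (simp add: ln_realpow)
  finally have "pg_log R (1/2) = of_real (?N * ln t)"
    using re by simp
  hence "exp (of_real (pg_q R / 2 ^ (pg_K R + 1)) * pg_log R (1/2)) = of_real (exp (pg_q R * ln t))"
    by (simp add: exp_of_real[symmetric])
  also have "exp (pg_q R * ln t) = t powr pg_q R"
    using t by (simp add: powr_def)
  finally have "pseudogamma R (1/2) =
      riemann_xi (1/2) * of_real ((inverse t) powr pg_q R * t powr pg_q R)"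
    by (simp add: pseudogamma_def t_def)
  also have "(inverse t) powr pg_q R * t powr pg_q R = 1"
    using t by (simp add: powr_mult[symmetric])
  finally show ?thesis by simp
qed

end

theory Submission
  imports Defs
begin

text \<open>
  The factors of the product run over all \<open>N\<close>-th roots of unity, where \<open>N = 2 ^ (pg_K R + 1)\<close>.
  With \<open>z = s - 1/2\<close>, \<open>w1 = pg_W1 R - 1/2\<close> and \<open>w2 = pg_W2 R - 1/2 = 3 * R\<close> it therefore collapses to
  \<open>(z ^ N - w1 ^ N) / (z ^ N - w2 ^ N)\<close>.  All arguments of the pseudogamma function that occur
  in the theorem satisfy \<open>norm z \<le> 3 * R / 2\<close>, so that \<open>z ^ N\<close> is smaller than both \<open>w1 ^ N\<close> and
  \<open>w2 ^ N\<close> by a factor \<open>u = (1/2) ^ N\<close>: on this disc the modulus of the product is constant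
  up to the factor \<open>(1 + u) / (1 - u)\<close>.  Raising to the power \<open>pg_q R / N\<close> does no harm, because
  \<open>N \<ge> R\<^sup>2\<close> while \<open>\<bar>pg_q R\<bar> \<le> 2 * R\<^sup>2\<close>.  Hence any two values of the pseudogamma function on the disc have
  moduli with quotient at most \<open>exp (16 / R\<^sup>2)\<close> (\<open>pseudogamma_ratio_le\<close>).  The quotients in the theorem consist
  of two such pairs, and \<open>32 / R\<^sup>2\<close> is far below \<open>11 * ln T / T powr (1/4)\<close>.

  The bound on \<open>pg_q R\<close> involves the logarithm of \<open>pg_Omega\<close>, and dividing two values of the pseudogamma
  function requires that they are nonzero.  Both come from a crude two-sided numerical estimate of
  \<open>riemann_xi (1/2)\<close>, that is, of \<open>Gamma (1/4)\<close> (from logarithmic convexity) and of \<open>riemann_zeta (1/2)\<close>.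
  The latter is read off from the continuation \<open>1 / (s - 1) + (\<Sum>n. zeta_defect s n)\<close>, whose series consists at
  \<open>s = 1/2\<close> of nonnegative reals dominated by a telescoping series.
\<close>

section \<open>The zeta function on a half-plane to the left of its pole\<close>

text \<open>
  The difference between \<open>(n + 1) powr (-s)\<close> and the integral of \<open>x powr (-s)\<close> over
  \<open>[n + 1, n + 2]\<close>, with the integral evaluated.
\<close>

definition zeta_defect :: "complex \<Rightarrow> nat \<Rightarrow> complex" where
  "zeta_defect s n = of_nat (Suc n) powr (-s)
     - (of_nat (Suc (Suc n)) powr (1 - s) - of_nat (Suc n) powr (1 - s)) / (1 - s)"

lemma norm_powr_diff_le:
  assumes "0 < x" "x \<le> y" "Re s > 0"
  shows "norm (of_real x powr (-s) - of_real y powr (-s)) \<le> norm s * x powr (-Re s - 1) * (y - x)"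
proof -
  let ?S = "closed_segment (complex_of_real x) (of_real y)"
  have S: "\<exists>t. w = of_real t \<and> x \<le> t" if "w \<in> ?S" for w
    using that assms by (auto simp: closed_segment_of_real closed_segment_eq_real_ivl)
  have "norm (of_real x powr (-s) - of_real y powr (-s))
      \<le> (norm s * x powr (-Re s - 1)) * norm (complex_of_real x - of_real y)"
  proof (rule field_differentiable_bound)
    show "convex ?S" by (rule convex_closed_segment)
    fix w assume "w \<in> ?S"
    then obtain t where t: "w = of_real t" "x \<le> t" using S by blast
    show "((\<lambda>z. z powr (-s)) has_field_derivative (-s) * w powr (-s - 1)) (at w within ?S)"
      using t assms
      by (intro has_field_derivative_at_within[OF has_field_derivative_powr])
        (auto simp: complex_nonpos_Reals_iff)
    have "t powr (-Re s - 1) \<le> x powr (-Re s - 1)"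
      using t assms by (intro powr_mono2') auto
    thus "norm ((-s) * w powr (-s - 1)) \<le> norm s * x powr (-Re s - 1)"
      using t assms by (auto simp: norm_mult norm_powr_real_powr intro!: mult_left_mono)
  qed auto
  also have "norm (complex_of_real x - of_real y) = y - x"
    using assms by (simp flip: of_real_diff)
  finally show ?thesis .
qed

text \<open>
  Averaging \<open>(n + 1) powr (-s) - x powr (-s)\<close> over an interval of length 1 gains one power of \<open>n\<close>
  over the Dirichlet series, which is what moves the abscissa of absolute convergence from 1 to 0.
  The average is expressed as an increment of a primitive, so that the mean value inequality applies.
\<close>

lemma norm_zeta_defect_le:
  assumes s: "Re s > 0" "s \<noteq> 1"
  shows "norm (zeta_defect s n) \<le> norm s * real (Suc n) powr (-Re s - 1)"
proof -
  define x where "x = real (Suc n)"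
  have x: "x > 0" by (simp add: x_def)
  let ?S = "closed_segment (complex_of_real x) (of_real (x + 1))"
  let ?G = "\<lambda>w. of_real x powr (-s) * w - w powr (1 - s) / (1 - s)"
  have "norm (?G (of_real (x + 1)) - ?G (of_real x))
      \<le> (norm s * x powr (-Re s - 1)) * norm (complex_of_real (x + 1) - of_real x)"
  proof (rule field_differentiable_bound)
    show "convex ?S" by (rule convex_closed_segment)
    fix w assume "w \<in> ?S"
    then obtain t where t: "w = of_real t" "x \<le> t" "t \<le> x + 1"
      by (auto simp: closed_segment_of_real closed_segment_eq_real_ivl simp del: of_real_add)
    have "(?G has_field_derivative of_real x powr (-s) - (1 - s) * w powr (1 - s - 1) / (1 - s))
            (at w)"
      using t x by (auto simp: complex_nonpos_Reals_iff intro!: derivative_eq_intros)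
    from has_field_derivative_at_within[OF this]
    show "(?G has_field_derivative of_real x powr (-s) - w powr (-s)) (at w within ?S)"
      using s by simp
    have "norm (of_real x powr (-s) - w powr (-s)) \<le> norm s * x powr (-Re s - 1) * (t - x)"
      unfolding t(1) using t x s by (intro norm_powr_diff_le) auto
    also have "\<dots> \<le> norm s * x powr (-Re s - 1) * 1"
      using t by (intro mult_left_mono) auto
    finally show "norm (of_real x powr (-s) - w powr (-s)) \<le> norm s * x powr (-Re s - 1)" by simp
  qed auto
  also have "?G (of_real (x + 1)) - ?G (of_real x) = zeta_defect s n"
    by (simp add: zeta_defect_def x_def algebra_simps diff_divide_distrib)
  finally show ?thesis by (simp add: x_def)
qed

definition zeta_ext :: "complex \<Rightarrow> complex" where
  "zeta_ext s = 1 / (s - 1) + (\<Sum>n. zeta_defect s n)"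

text \<open>
  Any abscissa strictly between \<open>0\<close> and \<open>1/2\<close> would do for evaluating at \<open>1/2\<close>;
  fixing \<open>1/4\<close> makes the exponent \<open>-5/4\<close> of the majorant independent of \<open>s\<close>.
\<close>

lemma summable_zeta_majorant: "summable (\<lambda>n. C * real (Suc n) powr (-5/4))"
  using summable_real_powr_iff[of "-5/4"] by (intro summable_mult) (subst summable_Suc_iff, simp)

lemma norm_zeta_defect_le_majorant:
  assumes "Re s > 1/4" "s \<noteq> 1" "norm s \<le> C"
  shows "norm (zeta_defect s n) \<le> C * real (Suc n) powr (-5/4)"
proof -
  have "norm (zeta_defect s n) \<le> norm s * real (Suc n) powr (-Re s - 1)"
    using assms by (intro norm_zeta_defect_le) auto
  also have "\<dots> \<le> C * real (Suc n) powr (-5/4)"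
    using assms order_trans[OF norm_ge_zero assms(3)] by (intro mult_mono powr_mono) auto
  finally show ?thesis .
qed

lemma summable_zeta_defect:
  assumes "Re s > 1/4" "s \<noteq> 1"
  shows "summable (zeta_defect s)"
  using norm_zeta_defect_le_majorant[OF assms order_refl]
  by (intro summable_comparison_test'[OF summable_zeta_majorant[of "norm s"], of 0])

lemma zeta_ext_holomorphic: "zeta_ext holomorphic_on {z. Re z > 1/4} - {1}"
proof -
  let ?S = "{z. Re z > 1/4} - {1::complex}"
  have op: "open ?S" by (intro open_Diff open_halfspace_Re_gt) auto
  have "(\<lambda>s. \<Sum>n. zeta_defect s n) holomorphic_on ?S"
  proof (rule holomorphic_uniform_sequence[OF op])
    show "(\<lambda>s. \<Sum>n<N. zeta_defect s n) holomorphic_on ?S" for N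
      unfolding zeta_defect_def by (auto intro!: holomorphic_intros simp del: of_nat_Suc)
  next
    fix x assume "x \<in> ?S"
    then obtain d where d: "d > 0" "cball x d \<subseteq> ?S"
      using op open_contains_cball by blast
    have "norm (zeta_defect s n) \<le> (norm x + d) * real (Suc n) powr (-5/4)"
      if "s \<in> cball x d" for s n
    proof (rule norm_zeta_defect_le_majorant)
      show "Re s > 1/4" "s \<noteq> 1" using that d by auto
      show "norm s \<le> norm x + d" using that norm_triangle_ineq2[of s x]
        by (auto simp: dist_norm norm_minus_commute)
    qed
    hence "uniform_limit (cball x d) (\<lambda>N s. \<Sum>n<N. zeta_defect s n) (\<lambda>s. \<Sum>n. zeta_defect s n) sequentially"
      by (rule Weierstrass_m_test[OF _ summable_zeta_majorant])
    with d show "\<exists>d>0. cball x d \<subseteq> ?S \<and>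
        uniform_limit (cball x d) (\<lambda>N s. \<Sum>n<N. zeta_defect s n) (\<lambda>s. \<Sum>n. zeta_defect s n) sequentially"
      by blast
  qed
  thus ?thesis unfolding zeta_ext_def by (auto intro!: holomorphic_intros)
qed

text \<open>
  The subtracted integrals telescope, and for \<open>Re z > 1\<close> they sum to \<open>1 / (z - 1)\<close>.
\<close>

lemma zeta_continuation_zeta_ext: "zeta_continuation (1/4) zeta_ext"
  unfolding zeta_continuation_def
proof (intro conjI allI impI zeta_ext_holomorphic)
  fix z :: complex assume z: "Re z > 1"
  \<comment> \<open>a primitive of \<open>x powr (-z)\<close> at the integers\<close>
  define p where "p = (\<lambda>n. (of_nat (Suc n) :: complex) powr (1 - z) / (1 - z))"
  have "(\<lambda>n. norm (p n)) = (\<lambda>n. real (Suc n) powr (1 - Re z) / norm (1 - z))"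
    by (simp add: p_def norm_divide norm_powr_real_powr fun_eq_iff del: of_nat_Suc)
  moreover have "(\<lambda>n. real (Suc n) powr (1 - Re z)) \<longlonglongrightarrow> 0"
    by (rule tendsto_neg_powr)
       (use z in \<open>auto intro!: filterlim_compose[OF filterlim_real_sequentially filterlim_Suc] simp del: of_nat_Suc\<close>)
  hence "(\<lambda>n. real (Suc n) powr (1 - Re z) / norm (1 - z)) \<longlonglongrightarrow> 0"
    by (rule tendsto_divide_zero)
  ultimately have "p \<longlonglongrightarrow> 0" by (metis tendsto_norm_zero_iff)
  hence "(\<lambda>n. p (Suc n) - p n) sums (0 - p 0)" by (rule telescope_sums)
  moreover have "zeta_defect z sums (\<Sum>n. zeta_defect z n)"
    using z by (intro summable_sums summable_zeta_defect) auto
  ultimately have "(\<lambda>n. zeta_defect z n + (p (Suc n) - p n)) sums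
      ((\<Sum>n. zeta_defect z n) + (0 - p 0))" by (intro sums_add)
  moreover have "(\<Sum>n. zeta_defect z n) + (0 - p 0) = zeta_ext z"
    using minus_divide_right[of 1 "1 - z"] by (simp add: zeta_ext_def p_def)
  moreover have "zeta_defect z n + (p (Suc n) - p n) = of_nat (Suc n) powr (-z)" for n
    by (simp add: zeta_defect_def p_def diff_divide_distrib)
  ultimately show "(\<lambda>n. of_nat (Suc n) powr (-z)) sums zeta_ext z" by simp
qed

text \<open>
  At \<open>1/2\<close> the \<open>n\<close>-th defect lies between \<open>0\<close> and
  \<open>1 / sqrt (n + 1) - 1 / sqrt (n + 2)\<close>, so the series lies between \<open>0\<close> and \<open>1\<close>, and the polar term
  contributes \<open>-2\<close>.
\<close>

lemma zeta_ext_half: "\<exists>x. zeta_ext (1/2) = of_real x \<and> -2 \<le> x \<and> x \<le> -1"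
proof -
  define a where "a = (\<lambda>n. 1 / sqrt (real (Suc n)) - 2 * (sqrt (real (Suc (Suc n))) - sqrt (real (Suc n))))"
  define r where "r = (\<lambda>n. - 1 / sqrt (real (Suc n)))"
  have pw: "complex_of_nat m powr (1/2) = of_real (sqrt (real m))"
           "complex_of_nat m powr (-(1/2)) = of_real (1 / sqrt (real m))" for m
    using powr_of_real[of "real m" "1/2"] powr_of_real[of "real m" "-(1/2)"]
    by (auto simp: powr_half_sqrt powr_minus_divide)
  have a: "zeta_defect (1/2) n = of_real (a n)" for n
    unfolding zeta_defect_def a_def by (simp add: pw del: of_nat_Suc)
  have bnd: "0 \<le> a n" "a n \<le> r (Suc n) - r n" for n
  proof -
    define u v where "u = sqrt (real (Suc n))" and "v = sqrt (real (Suc (Suc n)))"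
    have uv: "0 < u" "u \<le> v" "v\<^sup>2 = u\<^sup>2 + 1" by (auto simp: u_def v_def)
    \<comment> \<open>rationalising, the integral term \<open>2 * (v - u)\<close> is trapped between \<open>1 / v\<close> and \<open>1 / u\<close>\<close>
    hence v: "v - u = 1 / (v + u)" by (simp add: field_simps power2_eq_square)
    have "1 / (v + u) \<le> 1 / (2 * u)" "1 / (2 * v) \<le> 1 / (v + u)"
      using uv by (auto intro!: divide_left_mono)
    thus "0 \<le> a n" "a n \<le> r (Suc n) - r n"
      unfolding a_def r_def u_def[symmetric] v_def[symmetric] v by auto
  qed
  have "r \<longlonglongrightarrow> 0" unfolding r_def
    by (intro tendsto_divide_0[OF tendsto_const] filterlim_at_top_imp_at_infinity
      filterlim_compose[OF sqrt_at_top] filterlim_compose[OF filterlim_real_sequentially filterlim_Suc])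
  hence tel: "(\<lambda>n. r (Suc n) - r n) sums (0 - r 0)" by (rule telescope_sums)
  have sa: "summable a"
    using bnd by (intro summable_comparison_test'[OF sums_summable[OF tel], of 0]) auto
  have "suminf a \<le> 1"
    using suminf_le[OF bnd(2) sa sums_summable[OF tel]] sums_unique[OF tel] by (simp add: r_def)
  moreover have "0 \<le> suminf a" using bnd sa by (intro suminf_nonneg)
  moreover have "zeta_ext (1/2) = of_real (suminf a - 2)"
    unfolding zeta_ext_def a using suminf_of_real[OF sa, where 'a = complex] by simp
  ultimately show ?thesis by (intro exI[of _ "suminf a - 2"]) simp
qed

section \<open>The size of the xi function at the centre\<close>

lemma riemann_zeta_half_bounds: "\<exists>x. riemann_zeta (1/2) = of_real x \<and> -2 \<le> x \<and> x \<le> -1"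
  using zeta_ext_half riemann_zeta_eq[OF zeta_continuation_zeta_ext, of "1/2"] by simp

text \<open>
  Logarithmic convexity together with \<open>Gamma 1 = Gamma 2 = 1\<close>: the logarithm of Gamma is at most \<open>0\<close>
  between \<open>1\<close> and \<open>2\<close>, hence at \<open>5/4\<close>, and at least \<open>0\<close> to the left of \<open>1\<close>.
\<close>

lemma Gamma_quarter_bounds: "1 \<le> Gamma (1/4 :: real)" "Gamma (1/4 :: real) \<le> 4"
proof -
  have *: "(ln \<circ> Gamma) ((1 - t) *\<^sub>R x + t *\<^sub>R y) \<le> (1 - t) * (ln \<circ> Gamma) x + t * (ln \<circ> Gamma) y"
    if "0 \<le> t" "t \<le> 1" "x > 0" "y > 0" for t x y :: real
    using that convex_onD[OF log_convex_Gamma_real] by simp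
  have pos: "Gamma (1/4 :: real) > 0" "Gamma (5/4 :: real) > 0" by simp_all
  have G2: "Gamma (2::real) = 1" by (simp add: Gamma_numeral)
  \<comment> \<open>\<open>1\<close> is the convex combination \<open>4/7 * 1/4 + 3/7 * 2\<close>\<close>
  have "0 \<le> ln (Gamma (1/4 :: real))"
    using *[of "3/7" "1/4" 2] by (simp add: G2)
  thus "1 \<le> Gamma (1/4 :: real)" using pos by simp
  have "ln (Gamma (5/4 :: real)) \<le> 0"
    using *[of "1/4" 1 2] by (simp add: G2)
  hence "Gamma (5/4 :: real) \<le> 1" using pos by simp
  moreover have "Gamma (5/4 :: real) = 1/4 * Gamma (1/4)"
    using Gamma_plus1[of "1/4 :: real"] nonpos_Ints_nonpos[of "1/4 :: real"] by force
  ultimately show "Gamma (1/4 :: real) \<le> 4" by simp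
qed

text \<open>
  The defining formula is continuous at \<open>1/2\<close>, so the limit is its value.  Continuity of \<open>riemann_zeta\<close>
  is obtained by replacing it with the holomorphic function \<open>zeta_ext\<close> near \<open>1/2\<close>.
\<close>

lemma riemann_xi_half_eq:
  "riemann_xi (1/2) = - (1/8) * of_real pi powr (-1/4) * Gamma (1/4) * riemann_zeta (1/2)"
proof -
  define F where "F = (\<lambda>z. z * (z - 1) / 2 * of_real pi powr (- z / 2) * Gamma (z / 2) * zeta_ext z)"
  let ?S = "{z. Re z > 1/4} - {1::complex}"
  have op: "open ?S" by (intro open_Diff open_halfspace_Re_gt) auto
  have mem: "1/2 \<in> ?S" by simp
  have "F holomorphic_on ?S"
    unfolding F_def by (intro holomorphic_intros zeta_ext_holomorphic)
      (auto elim!: nonpos_Ints_cases simp: complex_eq_iff)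
  hence "F \<midarrow>1/2\<rightarrow> F (1/2)"
    using op mem continuous_on_interior[OF holomorphic_on_imp_continuous_on, of F ?S "1/2"]
    by (simp add: interior_open isCont_def)
  moreover have "\<forall>\<^sub>F z in at (1/2). F z =
      z * (z - 1) / 2 * of_real pi powr (- z / 2) * Gamma (z / 2) * riemann_zeta z"
    using eventually_at_in_open'[OF op mem]
    by eventually_elim (auto simp: F_def riemann_zeta_eq[OF zeta_continuation_zeta_ext])
  ultimately have "(\<lambda>z. z * (z - 1) / 2 * of_real pi powr (- z / 2) * Gamma (z / 2) * riemann_zeta z)
      \<midarrow>1/2\<rightarrow> F (1/2)"
    by (rule Lim_transform_eventually)
  hence "riemann_xi (1/2) = F (1/2)"
    unfolding riemann_xi_def by (intro tendsto_Lim) auto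
  thus ?thesis by (simp add: F_def riemann_zeta_eq[OF zeta_continuation_zeta_ext])
qed

lemma riemann_xi_half_bounds:
  "\<exists>x. riemann_xi (1/2) = of_real x \<and> 1/32 \<le> x \<and> x \<le> 1"
proof -
  obtain z where z: "riemann_zeta (1/2) = of_real z" "-2 \<le> z" "z \<le> -1"
    using riemann_zeta_half_bounds by blast
  have p: "1/4 \<le> pi powr (-1/4)" "pi powr (-1/4) \<le> 1"
  proof -
    show "pi powr (-1/4) \<le> 1"
      using powr_mono[of "-1/4" 0 pi] pi_ge_two by simp
    have "pi powr (1/4) \<le> 4 powr 1"
      using pi_less_4 pi_ge_two powr_mono[of "1/4" 1 pi] by simp
    thus "1/4 \<le> pi powr (-1/4)"
      using pi_gt_zero by (simp add: powr_minus_divide field_simps)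
  qed
  have "complex_of_real pi powr (-1/4) = of_real (pi powr (-1/4))"
    using powr_of_real[of pi "-1/4"] pi_gt_zero by simp
  moreover have "Gamma (1/4 :: complex) = of_real (Gamma (1/4))"
    using Gamma_complex_of_real[of "1/4"] by simp
  ultimately have "riemann_xi (1/2) = of_real (1/8 * (pi powr (-1/4) * (Gamma (1/4) * (-z))))"
    by (simp add: riemann_xi_half_eq z)
  moreover have "0 \<le> Gamma (1/4) * (-z)"
    using z by (intro mult_nonneg_nonneg) auto
  hence "pi powr (-1/4) * (Gamma (1/4) * (-z)) \<le> 1 * (4 * 2)"
    using p z Gamma_quarter_bounds by (intro mult_mono) auto
  moreover have "1/4 * (1 * 1) \<le> pi powr (-1/4) * (Gamma (1/4) * (-z))"
    using p z Gamma_quarter_bounds by (intro mult_mono) auto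
  ultimately show ?thesis
    by (intro exI[of _ "1/8 * (pi powr (-1/4) * (Gamma (1/4) * (-z)))"] conjI) linarith+
qed

lemma abs_ln_pg_Omega_le: "\<bar>ln pg_Omega\<bar> \<le> 2000"
proof -
  obtain x where x: "riemann_xi (1/2) = of_real x" "1/32 \<le> x" "x \<le> 1"
    using riemann_xi_half_bounds by blast
  have "1 \<le> pg_Omega" "pg_Omega \<le> 2000"
    using x by (auto simp: pg_Omega_def field_simps)
  thus ?thesis using ln_le_minus_one[of pg_Omega] by auto
qed

section \<open>The product over roots of unity\<close>

text \<open>
  The factorisation of \<open>z ^ N - w ^ N\<close> over the roots of unity for \<open>N = 2 ^ m\<close>.  Pairing each root with its
  negative, which lies half a turn further on, replaces \<open>z\<close> and \<open>w\<close> by their squares and halves the number of factors.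
\<close>

lemma prod_dyadic_roots_of_unity:
  fixes z w :: complex
  shows "(\<Prod>k = 1..2^m. z - cis (2 * real k * pi / 2^m) * w) = z ^ 2^m - w ^ 2^m"
proof (induction m arbitrary: z w)
  case 0
  show ?case by simp
next
  case (Suc m)
  let ?N = "2 ^ m :: nat"
  let ?f = "\<lambda>k. z - cis (2 * real k * pi / 2 ^ Suc m) * w"
  have opp: "?f (k + ?N) = z + cis (2 * real k * pi / 2 ^ Suc m) * w" for k
  proof -
    have "2 * real (k + ?N) * pi / 2 ^ Suc m = 2 * real k * pi / 2 ^ Suc m + pi"
      by (simp add: field_simps)
    hence "cis (2 * real (k + ?N) * pi / 2 ^ Suc m) = - cis (2 * real k * pi / 2 ^ Suc m)"
      by (simp only: cis_mult[symmetric]) simp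
    thus ?thesis by simp
  qed
  have sq: "?f k * ?f (k + ?N) = z\<^sup>2 - cis (2 * real k * pi / 2 ^ m) * w\<^sup>2" for k
  proof -
    have "cis (2 * real k * pi / 2 ^ m) = (cis (2 * real k * pi / 2 ^ Suc m))\<^sup>2"
      by (simp add: power2_eq_square cis_mult mult_ac)
    thus ?thesis unfolding opp by (simp add: algebra_simps power2_eq_square)
  qed
  have "{1..2 ^ Suc m} = {1..?N} \<union> {1 + ?N..?N + ?N}" by auto
  hence "prod ?f {1..2 ^ Suc m} = prod ?f {1..?N} * prod ?f {1 + ?N..?N + ?N}"
    by (simp only:) (rule prod.union_disjoint, auto)
  also have "prod ?f {1 + ?N..?N + ?N} = (\<Prod>k = 1..?N. ?f (k + ?N))"
    by (rule prod.shift_bounds_cl_nat_ivl)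
  also have "prod ?f {1..?N} * \<dots> = (\<Prod>k = 1..?N. ?f k * ?f (k + ?N))"
    by (rule prod.distrib[symmetric])
  also have "\<dots> = (z\<^sup>2) ^ ?N - (w\<^sup>2) ^ ?N"
    unfolding sq by (rule Suc.IH)
  finally show ?case by (simp add: power_mult)
qed

lemma pg_prod_eq:
  fixes R :: real
  defines "N \<equiv> 2 ^ (pg_K R + 1)"
  shows "pg_prod R s = ((s - 1/2) ^ N - of_real (pg_W1 R - 1/2) ^ N) /
                       ((s - 1/2) ^ N - of_real (pg_W2 R - 1/2) ^ N)"
proof -
  have "cis (real k * pi / 2 ^ pg_K R) = cis (2 * real k * pi / 2 ^ (pg_K R + 1))" for k
    by simp
  thus ?thesis unfolding pg_prod_def pg_factor_def N_def prod_dividef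
    by (simp only: prod_dyadic_roots_of_unity)
qed

lemma norm_power_diff_bounds:
  fixes z :: complex
  assumes "norm z \<le> w / 2" "0 < w"
  shows "norm (z ^ N - of_real w ^ N) \<le> (1 + (1/2) ^ N) * w ^ N"
    and "norm (z ^ N - of_real w ^ N) \<ge> (1 - (1/2) ^ N) * w ^ N"
proof -
  have "norm (z ^ N) \<le> (w/2) ^ N" using assms by (simp add: norm_power power_mono)
  hence "norm (z ^ N) \<le> (1/2) ^ N * w ^ N" by (simp add: power_divide)
  moreover have "norm (of_real w ^ N :: complex) = w ^ N" using assms by (simp add: norm_power)
  ultimately show "norm (z ^ N - of_real w ^ N) \<le> (1 + (1/2) ^ N) * w ^ N"
    "norm (z ^ N - of_real w ^ N) \<ge> (1 - (1/2) ^ N) * w ^ N"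
    using norm_triangle_ineq4[of "z ^ N" "of_real w ^ N"] norm_triangle_ineq2[of "of_real w ^ N" "z ^ N"]
    by (auto simp: algebra_simps norm_minus_commute)
qed

text \<open>
  Numerator and denominator of the collapsed product have moduli \<open>w1 ^ N\<close> and \<open>w2 ^ N\<close> up to a relative
  error \<open>u\<close>.  With \<open>M = (w1 / w2) ^ N\<close>, both values of the product therefore have modulus between
  \<open>(1 - u) / (1 + u) * M\<close> and \<open>(1 + u) / (1 - u) * M\<close>.
\<close>

lemma norm_pg_prod_ratio:
  fixes z z' :: complex
  assumes R: "R > 0" and z: "norm (z - 1/2) \<le> 3 * R / 2" "norm (z' - 1/2) \<le> 3 * R / 2"
  defines "u \<equiv> (1/2) ^ (2 ^ (pg_K R + 1)) :: real"
  shows "norm (pg_prod R z) > 0"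
    "norm (pg_prod R z) / norm (pg_prod R z') \<le> exp (8 * u)"
proof -
  define N :: nat where "N = 2 ^ (pg_K R + 1)"
  define w1 w2 where "w1 = pg_W1 R - 1/2" and "w2 = pg_W2 R - 1/2"
  have w: "w1 \<ge> 3 * R" "w2 = 3 * R" by (auto simp: w1_def w2_def pg_W1_def pg_W2_def)
  have uN: "u = (1/2) ^ N" unfolding u_def N_def ..
  have "N \<ge> 2" by (simp add: N_def)
  hence u: "0 < u" "u \<le> 1/4"
    using power_decreasing[of 2 N "1/2 :: real"] by (auto simp: uN power2_eq_square)
  have rho: "(1 + u) / (1 - u) \<le> exp (4 * u)"
  proof -
    have "(1 + u) / (1 - u) \<le> 1 + 4 * u" using u by (auto simp: field_simps)
    also have "\<dots> \<le> exp (4 * u)" by (rule exp_ge_add_one_self)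
    finally show ?thesis .
  qed
  define M where "M = w1 ^ N / w2 ^ N"
  have M: "M > 0" using w R by (auto simp: M_def)
  have bnds: "norm (pg_prod R s) \<ge> (1 - u) / (1 + u) * M" "norm (pg_prod R s) \<le> (1 + u) / (1 - u) * M"
    if "norm (s - 1/2) \<le> 3 * R / 2" for s
  proof -
    have "norm (s - 1/2) \<le> w1 / 2" "norm (s - 1/2) \<le> w2 / 2" "0 < w1" "0 < w2"
      using that w R by auto
    note * = norm_power_diff_bounds[OF this(1,3), of N, folded uN]
      norm_power_diff_bounds[OF this(2,4), of N, folded uN]
    have pos: "(1 - u) * w2 ^ N > 0" "(1 - u) * w1 ^ N > 0" using u w R by auto
    have eq: "norm (pg_prod R s) =
        norm ((s - 1/2) ^ N - of_real w1 ^ N) / norm ((s - 1/2) ^ N - of_real w2 ^ N)"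
      unfolding pg_prod_eq N_def w1_def w2_def by (rule norm_divide)
    have "((1 - u) * w1 ^ N) / ((1 + u) * w2 ^ N) \<le> norm (pg_prod R s)"
      unfolding eq using * pos by (intro frac_le) auto
    thus "norm (pg_prod R s) \<ge> (1 - u) / (1 + u) * M" by (simp add: M_def)
    have "norm (pg_prod R s) \<le> ((1 + u) * w1 ^ N) / ((1 - u) * w2 ^ N)"
      unfolding eq using * pos by (intro frac_le) auto
    thus "norm (pg_prod R s) \<le> (1 + u) / (1 - u) * M" by (simp add: M_def)
  qed
  have low: "0 < (1 - u) / (1 + u) * M" using u M by auto
  show "norm (pg_prod R z) > 0" using bnds(1)[OF z(1)] low by linarith
  have "norm (pg_prod R z) / norm (pg_prod R z') \<le> ((1 + u) / (1 - u) * M) / ((1 - u) / (1 + u) * M)"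
    using bnds[OF z(1)] bnds[OF z(2)] low by (intro frac_le) auto
  also have "\<dots> = ((1 + u) / (1 - u)) * ((1 + u) / (1 - u))" using M u by simp
  also have "\<dots> \<le> exp (4 * u) * exp (4 * u)" using rho u by (intro mult_mono) auto
  also have "\<dots> = exp (8 * u)" by (simp flip: exp_add)
  finally show "norm (pg_prod R z) / norm (pg_prod R z') \<le> exp (8 * u)" .
qed

section \<open>The pseudogamma function is almost of constant modulus\<close>

text \<open>
  Only the real part of \<open>pg_log R s\<close> enters the modulus, and on the disc it is the logarithm of the
  modulus of the product for every branch.
\<close>

lemma norm_pseudogamma:
  assumes "R > 0" "s \<in> ball (1/2) (3 * R)"
  shows "norm (pseudogamma R s) = norm (riemann_xi (1/2))
    * ((pg_W2 R - 1/2) / (pg_W1 R - 1/2)) powr pg_q R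
    * norm (pg_prod R s) powr (pg_q R / 2 ^ (pg_K R + 1))"
proof -
  have "exp (pg_log R s) = pg_prod R s"
    using is_pg_log_pg_log[OF assms(1)] assms(2) by (simp add: is_pg_log_def)
  hence "norm (pg_prod R s) = exp (Re (pg_log R s))" by (metis norm_exp_eq_Re)
  hence "norm (pg_prod R s) powr (pg_q R / 2 ^ (pg_K R + 1))
       = norm (exp (of_real (pg_q R / 2 ^ (pg_K R + 1)) * pg_log R s))"
    by (simp add: powr_def norm_exp_eq_Re Re_divide_of_real flip: of_real_power)
  thus ?thesis by (simp add: pseudogamma_def norm_mult)
qed

text \<open>
  The bound is very rough: beyond \<open>ln (R / 2) \<le> R\<close> it only needs \<open>R\<close> to dominate the constant from \<open>ln pg_Omega\<close>.
\<close>

lemma abs_pg_q_le: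
  assumes R: "R \<ge> 1000"
  shows "\<bar>pg_q R\<bar> \<le> 2 * R\<^sup>2"
proof -
  have "0 \<le> ln (R / 2)" "ln (R / 2) \<le> R"
    using R ln_le_minus_one[of "R / 2"] by auto
  hence "\<bar>(R + 10) * ln (R / 2)\<bar> \<le> (R + 10) * R"
    using R by (auto simp: abs_mult intro!: mult_left_mono)
  hence "\<bar>(R + 10) * ln (R / 2) + 4 * ln pg_Omega\<bar> \<le> (R + 10) * R + 8000"
    using abs_ln_pg_Omega_le by linarith
  also have "\<dots> \<le> 2 * R\<^sup>2"
  proof -
    have "10 * R + 8000 \<le> 1000 * R" using R by simp
    also have "1000 * R \<le> R * R" using R by (intro mult_right_mono) auto
    finally show ?thesis by (simp add: power2_eq_square algebra_simps)
  qed
  finally have num: "\<bar>(R + 10) * ln (R / 2) + 4 * ln pg_Omega\<bar> \<le> 2 * R\<^sup>2" .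
  have den: "4 * pg_gamma * R powr (1/4) \<ge> 1"
    using R ge_one_powr_ge_zero[of R "1/4"] by (simp add: pg_gamma_def)
  have "\<bar>pg_q R\<bar> = \<bar>(R + 10) * ln (R / 2) + 4 * ln pg_Omega\<bar> / (4 * pg_gamma * R powr (1/4))"
    unfolding pg_q_def abs_divide using den by simp
  also have "\<dots> \<le> (2 * R\<^sup>2) / 1"
    using num den by (intro frac_le) auto
  finally show ?thesis by simp
qed

text \<open>
  The quotient defining \<open>pg_K R\<close> is the base-2 logarithm of \<open>B * R\<^sup>2\<close> with \<open>B \<ge> 1\<close>; the extra \<open>+ 1\<close> in the number of
  factors compensates for rounding it down.
\<close>

lemma square_le_num_pg_factors:
  assumes R: "R \<ge> 1"
  shows "R\<^sup>2 \<le> 2 ^ (pg_K R + 1)"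
proof -
  define B where "B = 10/27 * (15 + 4 / R powr (3/4)) * R powr (1/4) + 2 / (3 * R powr (3/4))"
  have "10/27 * 15 * 1 \<le> 10/27 * (15 + 4 / R powr (3/4)) * R powr (1/4)"
    using R by (intro mult_mono ge_one_powr_ge_zero) auto
  moreover have "0 \<le> 2 / (3 * R powr (3/4))" by simp
  ultimately have B: "B \<ge> 1" unfolding B_def by linarith
  define L where "L = (ln B + 2 * ln R) / ln 2"
  have "2 powr L = B * R\<^sup>2"
    using B R by (simp add: L_def powr_def exp_add exp_of_nat_mult[of 2 "ln R", simplified])
  moreover have "2 powr L \<le> 2 powr real (pg_K R + 1)"
    unfolding pg_K_def B_def[symmetric] L_def[symmetric]
    by (intro powr_mono) linarith+
  moreover have "1 * R\<^sup>2 \<le> B * R\<^sup>2" using B by (intro mult_right_mono) auto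
  ultimately show ?thesis
    using powr_realpow[of 2 "pg_K R + 1"] by linarith
qed

lemma powr_le_exp_abs:
  fixes x :: real
  assumes "x > 0" "x \<le> exp b" "1 / x \<le> exp b"
  shows "x powr e \<le> exp (\<bar>e\<bar> * b)"
proof -
  have "exp (-b) \<le> x" using assms by (simp add: exp_minus field_simps)
  hence "ln (exp (-b)) \<le> ln x" "ln x \<le> ln (exp b)"
    using assms by (simp_all only: ln_le_cancel_iff exp_gt_zero)
  hence "\<bar>ln x\<bar> \<le> b" by simp
  hence "\<bar>e * ln x\<bar> \<le> \<bar>e\<bar> * b" by (auto simp: abs_mult intro!: mult_left_mono)
  thus ?thesis using assms by (simp add: powr_def)
qed

text \<open>
  The exponent \<open>e = pg_q R / N\<close> is at most \<open>2\<close> in absolute value, and \<open>u = (1/2) ^ N \<le> 1 / N \<le> 1 / R\<^sup>2\<close>.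
  The first factor of \<open>norm_pseudogamma\<close> cancels because \<open>riemann_xi (1/2)\<close> is nonzero.
\<close>

lemma pseudogamma_ratio_le:
  assumes R: "R \<ge> 1000" and z: "norm (z - 1/2) \<le> 3 * R / 2" "norm (z' - 1/2) \<le> 3 * R / 2"
  shows "norm (pseudogamma R z / pseudogamma R z') \<le> exp (16 / R\<^sup>2)"
proof -
  define n where "n = pg_K R + 1"
  define u where "u = (1/2 :: real) ^ (2 ^ n)"
  define e where "e = pg_q R / 2 ^ n"
  let ?x = "norm (pg_prod R z) / norm (pg_prod R z')"
  have ball: "z \<in> ball (1/2) (3 * R)" "z' \<in> ball (1/2) (3 * R)"
    using z R by (auto simp: dist_norm norm_minus_commute)
  have R0: "R > 0" using R by simp
  have c: "norm (riemann_xi (1/2)) * ((pg_W2 R - 1/2) / (pg_W1 R - 1/2)) powr pg_q R \<noteq> 0"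
    using riemann_xi_half_bounds R0 by (auto simp: pg_W1_def pg_W2_def add_nonneg_eq_0_iff)
  have "norm (pseudogamma R z / pseudogamma R z') = ?x powr e"
    unfolding norm_divide norm_pseudogamma[OF R0 ball(1)] norm_pseudogamma[OF R0 ball(2)]
      n_def[symmetric] e_def[symmetric]
    using c by (simp add: powr_divide)
  also have "\<dots> \<le> exp (\<bar>e\<bar> * (8 * u))"
    using norm_pg_prod_ratio[OF R0 z] norm_pg_prod_ratio[OF R0 z(2) z(1)]
    unfolding u_def n_def by (intro powr_le_exp_abs) auto
  also have "\<dots> \<le> exp (16 / R\<^sup>2)"
  proof -
    have n: "R\<^sup>2 \<le> 2 ^ n" unfolding n_def using R by (intro square_le_num_pg_factors) auto
    have R2: "0 < R\<^sup>2" using R by simp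
    have "u = 1 / 2 ^ (2 ^ n)" by (simp add: u_def power_divide)
    also have "\<dots> \<le> 1 / R\<^sup>2"
    proof (intro divide_left_mono)
      have "(2 :: real) ^ n \<le> 2 ^ (2 ^ n)"
        by (intro power_increasing less_imp_le[OF less_exp]) simp
      with n show "R\<^sup>2 \<le> 2 ^ (2 ^ n)" by (rule order_trans)
    qed (use R2 in auto)
    finally have u: "u \<le> 1 / R\<^sup>2" .
    have "\<bar>e\<bar> = \<bar>pg_q R\<bar> / 2 ^ n" by (simp add: e_def)
    also have "\<dots> \<le> (2 * R\<^sup>2) / R\<^sup>2"
      using abs_pg_q_le[OF R] n R2 by (intro frac_le) auto
    finally have "\<bar>e\<bar> \<le> 2" using R2 by simp
    hence "\<bar>e\<bar> * (8 * u) \<le> 2 * (8 * (1 / R\<^sup>2))"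
      using u by (intro mult_mono) (auto simp: u_def)
    thus ?thesis by simp
  qed
  finally show ?thesis .
qed

theorem lemma4:
  fixes T R \<eta> X Y0 Y Y1 t0 :: real
    and s0 s :: complex
    and C D :: "complex \<Rightarrow> complex"
  assumes "T \<ge> 2445999556027"
    and "2 * T - 1 < R" and "R \<le> 2 * T + 1"
    and "0 < \<eta>" and "\<eta> < 1/4"
    and "1/2 < X" and "X < 1"
    and "Y = Y0 + \<eta> / 4" and "Y1 = Y0 + 3 * \<eta> / 4"
    and "T - \<eta> / 4 < Y" and "Y < Y1" and "Y1 < T + 3 * \<eta> / 4"
    and "T - 3/2 < t0" and "t0 \<le> T + 3/2"
    and "s0 = Complex (5/4) t0"
    and "C = (\<lambda>z. pseudogamma R (3/2 + z) / pseudogamma R (of_real X - 1/2 + z))"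
    and "D = (\<lambda>z. pseudogamma R (z + \<i> * of_real Y1) / pseudogamma R (z + \<i> * of_real Y))"
    and "norm (s - s0) = 1"
  shows "norm (C s / C s0) \<le> T powr (11 / T powr (1/4)) \<and>
         norm (D s / D s0) \<le> T powr (11 / T powr (1/4))"
proof -
  have s0: "norm s0 \<le> T + 3"
    using assms cmod_le[of s0] by simp
  have s: "norm s \<le> T + 4"
    using s0 norm_triangle_ineq2[of s s0] assms by linarith
  (* R is close to 2 T, so the disc has radius close to 3 T, while arguments reach to about 2 T. *)
  have shift: "norm (z + a - 1/2) \<le> 3 * R / 2"
    if "norm z \<le> T + 4" "norm a \<le> T + 2" for z a :: complex
  proof -
    have "norm (z + a - 1/2) \<le> norm z + norm a + norm (1/2 :: complex)"
      by (intro order_trans[OF norm_triangle_ineq4] add_right_mono norm_triangle_ineq)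
    thus ?thesis using that assms(1-3) by simp
  qed
  (* Both C and D are quotients of two translates, so f s / f s0 regroups into two quotients of
     pseudogamma values on the disc. *)
  have ratio: "norm (f s / f s0) \<le> T powr (11 / T powr (1/4))"
    if f: "f = (\<lambda>z. pseudogamma R (z + a) / pseudogamma R (z + b))"
      and ab: "norm a \<le> T + 2" "norm b \<le> T + 2" for f a b
  proof -
    have R: "R \<ge> 1000" using assms by simp
    have s0': "norm s0 \<le> T + 4" using s0 by simp
    have "norm (f s / f s0) =
        norm (pseudogamma R (s + a) / pseudogamma R (s + b)) *
        norm (pseudogamma R (s0 + b) / pseudogamma R (s0 + a))"
      unfolding f by (simp add: norm_divide norm_mult)
    also have "\<dots> \<le> exp (16 / R\<^sup>2) * exp (16 / R\<^sup>2)"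
      using s s0' ab R by (intro mult_mono pseudogamma_ratio_le shift) auto
    also have "\<dots> = exp (32 / R\<^sup>2)" by (simp flip: exp_add)
    also have "32 / R\<^sup>2 \<le> 11 / T powr (1/4) * ln T"
    proof -
      have "T * T \<le> R * R" using assms by (intro mult_mono) auto
      hence "32 / R\<^sup>2 \<le> 32 / (T * T)"
        using assms by (intro divide_left_mono) (auto simp: power2_eq_square)
      also have "\<dots> \<le> 11 / T" using assms by (simp add: field_simps)
      also have "T powr (1/4) \<le> T" using powr_mono[of "1/4" 1 T] assms by simp
      hence "11 / T \<le> 11 / T powr (1/4)" using assms by (intro divide_left_mono) auto
      also have "1 \<le> ln T" using assms exp_le by (subst ln_ge_iff) auto
      hence "11 / T powr (1/4) * 1 \<le> 11 / T powr (1/4) * ln T" by (intro mult_left_mono) auto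
      finally show ?thesis by simp
    qed
    hence "exp (32 / R\<^sup>2) \<le> T powr (11 / T powr (1/4))"
      using assms by (simp add: powr_def)
    finally show ?thesis .
  qed
  have "norm (complex_of_real X - 1/2) \<le> 1"
    using norm_triangle_ineq4[of "complex_of_real X" "1/2"] norm_of_real[of X] assms(6,7)
    by (simp add: cmod_def)
  hence "norm (C s / C s0) \<le> T powr (11 / T powr (1/4))"
    using assms by (intro ratio[where a = "3/2" and b = "of_real X - 1/2"]) (auto simp: add.commute)
  moreover have "norm (D s / D s0) \<le> T powr (11 / T powr (1/4))"
  proof (rule ratio[OF assms(17)])
    show "norm (\<i> * complex_of_real Y1) \<le> T + 2" "norm (\<i> * complex_of_real Y) \<le> T + 2"
      using assms(1,4,5,10-12) by (simp_all only: norm_mult norm_ii norm_of_real mult_1_left abs_le_iff) simp_all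
  qed
  ultimately show ?thesis by blast
qed

end
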